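(* Let $p,s\ge1$ and let $\mathbf{H}_j\in\mathbb{H}^{n_j}(\mathbb{R}^2)$, $1\le j\le p+s$, be harmonic tensors with $n_j\ge1$; write $\phi(\mathbf{H}_j)=\mathrm{Re}(\overline{z}_jz^{n_j})$ with $z_j\in\mathbb{C}$, $z=x+iy$. Let $N_1=n_1+\dots+n_p$, $N_2=n_{p+1}+\dots+n_{p+s}$ and assume $N_1\le N_2$. Then $$\mathrm{Re}\left(z_1\cdots z_p\,\overline{z}_{p+1}\cdots\overline{z}_{p+s}\,z^{N_2-N_1}\right)=2^{\,p+s-1-N_1}\,\phi\left((\mathbf{H}_1\odot\dots\odot\mathbf{H}_p)'\overset{(N_1)}{\cdot}(\mathbf{H}_{p+1}\odot\dots\odot\mathbf{H}_{p+s})'\right),$$ and $$\begin{aligned} &\mathrm{Im}\left(z_1\cdots z_p\,\overline{z}_{p+1}\cdots\overline{z}_{p+s}\,z^{N_2-N_1}\right)\\ &\quad=\frac{2^{\,p+s-2N_1}(N_1+N_2-2)!}{(N_1-1)!\,(N_2-1)!}\,\phi\left(\mathrm{tr}^{(N_1-1)}\left((\mathbf{H}_1\odot\dots\odot\mathbf{H}_p)'\times(\mathbf{H}_{p+1}\odot\dots\odot\mathbf{H}_{p+s})'\right)\right)\\ &\quad=2^{\,p+s-1-N_1}\,\phi\left((\mathbf{H}_1\odot\dots\odot\mathbf{H}_p)'\overset{(N_1)}{\cdot}([\mathbf{1}\times\mathbf{H}_{p+1}]\odot\mathbf{H}_{p+2}\odot\dots\odot\mathbf{H}_{p+s})'\right)\\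 &\quad=-2^{\,p+s-1-N_1}\,\phi\left(([\mathbf{1}\times\mathbf{H}_1]\odot\mathbf{H}_2\odot\dots\odot\mathbf{H}_p)'\overset{(N_1)}{\cdot}(\mathbf{H}_{p+1}\odot\dots\odot\mathbf{H}_{p+s})'\right). \end{aligned}$$
   Context: $\mathbb{S}^n(\mathbb{R}^2)$ is the space of totally symmetric tensors of order $n$ on Euclidean $\mathbb{R}^2$; $\mathbb{H}^n(\mathbb{R}^2)$ is its subspace of harmonic (traceless) tensors. $\phi(\mathbf{S})(\mathbf{x})=\mathbf{S}(\mathbf{x},\dots,\mathbf{x})$, $\mathbf{x}=(x,y)$; this also makes sense for arbitrary tensors, with $\phi(\mathbf{T})=\phi(\mathbf{T}^s)$, $\mathbf{T}^s$ being the total symmetrization; for order $0$, $\phi$ is the identity. Harmonic tensors of order $n$ correspond to harmonic polynomials $\mathrm{Re}(\overline{z}_jz^{n})$, $z_j\in\mathbb{C}$. $\mathbf{S}_1\odot\mathbf{S}_2=(\mathbf{S}_1\otimes\mathbf{S}_2)^s$. $\overset{(r)}{\cdot}$ is the $r$-contraction $(\mathbf{T}_1\overset{(r)}{\cdot}\mathbf{T}_2)_{i_1\cdots i_{n_1-r}j_{r+1}\cdots j_{n_2}}=T^1_{i_1\cdots i_{n_1-r}k_1\cdots k_r}T^2_{k_1\cdots k_rj_{r+1}\cdots j_{n_2}}$ (summation over repeated indices, orthonormal basis). $\mathbf{S}_1\times\mathbf{S}_2:=-(\mathbf{S}_1\cdot\boldsymbol{\varepsilon}\cdot\mathbf{S}_2)^s\in\mathbb{S}^{n_1+n_2-2}$,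 where $\varepsilon_{ij}=\det(\mathbf{e}_i,\mathbf{e}_j)$; equivalently $\phi(\mathbf{S}_1\times\mathbf{S}_2)=-\frac{1}{n_1n_2}\det(\nabla\mathrm{p}_1,\nabla\mathrm{p}_2)$, $\mathrm{p}_i=\phi(\mathbf{S}_i)$. $\mathbf{1}$ is the identity second-order tensor. $\mathrm{tr}^{(k)}$ is the $k$-fold trace of a totally symmetric tensor ($k$ pairs of indices contracted). $\mathbf{S}'$ is the leading harmonic part of $\mathbf{S}\in\mathbb{S}^n$: $\phi(\mathbf{S}')=\mathrm{h}_0$ in the unique decomposition $\phi(\mathbf{S})=\mathrm{h}_0+\mathrm{q}\,\mathrm{h}_1+\dots+\mathrm{q}^r\mathrm{h}_r$, $\mathrm{q}=x^2+y^2$, $r=\lfloor n/2\rfloor$, with $\mathrm{h}_k$ homogeneous harmonic of degree $n-2k$. *)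

theory Defs
  imports "HOL-Analysis.Analysis"
begin

text \<open>
  A tensor of order n on the Euclidean plane is an n-linear form, taken as a function of the list of
  its n arguments. It vanishes on lists of any other length, so that equality of functions is
  equality of tensors. Components are the values on lists of vectors of the standard orthonormal
  basis \<open>Basis\<close>. The order cannot be read off the type, hence the operations below that depend on
  it take it as a parameter.
\<close>

type_synonym tensor = "(real^2) list \<Rightarrow> real"

definition tensors :: "nat \<Rightarrow> tensor set" where
  "tensors n = {T. (\<forall>vs. length vs \<noteq> n \<longrightarrow> T vs = 0) \<and>
     (\<forall>vs i. length vs = n \<longrightarrow> i < n \<longrightarrow> linear (\<lambda>v. T (vs[i := v])))}"

definition sym_tensors :: "nat \<Rightarrow> tensor set" where
  "sym_tensors n = {T \<in> tensors n.
     \<forall>\<sigma> vs. \<sigma> permutes {..<n} \<longrightarrow> length vs = n \<longrightarrow> T (permute_list \<sigma> vs) = T vs}"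

text \<open>
  The trace contracts the first two indices; for the totally symmetric tensors to which it is applied
  the choice of the pair is irrelevant. On tensors of order 0 and 1 it is zero, so all of these
  are harmonic.
\<close>

definition tensor_trace :: "tensor \<Rightarrow> tensor" where
  "tensor_trace T = (\<lambda>vs. \<Sum>b\<in>Basis. T (b # b # vs))"

definition harmonic_tensors :: "nat \<Rightarrow> tensor set" where
  "harmonic_tensors n = {T \<in> sym_tensors n. tensor_trace T = (\<lambda>vs. 0)}"

definition phi :: "nat \<Rightarrow> tensor \<Rightarrow> real^2 \<Rightarrow> real" where
  "phi n T x = T (replicate n x)"

definition symmetrize :: "nat \<Rightarrow> tensor \<Rightarrow> tensor" where
  "symmetrize n T = (\<lambda>vs. if length vs = n
     then (\<Sum>\<sigma> | \<sigma> permutes {..<n}. T (permute_list \<sigma> vs)) / fact n else 0)"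

definition contract :: "nat \<Rightarrow> nat \<Rightarrow> nat \<Rightarrow> tensor \<Rightarrow> tensor \<Rightarrow> tensor" where
  "contract r m n S T = (\<lambda>vs. if length vs = (m - r) + (n - r)
     then \<Sum>ks | set ks \<subseteq> Basis \<and> length ks = r.
            S (take (m - r) vs @ ks) * T (ks @ drop (m - r) vs)
     else 0)"

definition tensor_prod :: "nat \<Rightarrow> nat \<Rightarrow> tensor \<Rightarrow> tensor \<Rightarrow> tensor" where
  "tensor_prod m n S T = (\<lambda>vs. if length vs = m + n then S (take m vs) * T (drop m vs) else 0)"

definition sym_prod :: "nat \<Rightarrow> nat \<Rightarrow> tensor \<Rightarrow> tensor \<Rightarrow> tensor" where
  "sym_prod m n S T = symmetrize (m + n) (tensor_prod m n S T)"

text \<open>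
  \<open>sym_prods n H [a, \<dots>, b]\<close> is the symmetric product of the tensors \<open>H a, \<dots>, H b\<close> of orders
  \<open>n a, \<dots>, n b\<close>. The symmetric product is associative, so the bracketing does not matter.
  The value on the empty list is the scalar 1.
\<close>

fun sym_prods :: "(nat \<Rightarrow> nat) \<Rightarrow> (nat \<Rightarrow> tensor) \<Rightarrow> nat list \<Rightarrow> tensor" where
  "sym_prods n H [] = (\<lambda>vs. if vs = [] then 1 else 0)"
| "sym_prods n H [j] = H j"
| "sym_prods n H (j # js) = sym_prod (n j) (\<Sum>i\<leftarrow>js. n i) (H j) (sym_prods n H js)"

definition id_tensor :: tensor where
  "id_tensor vs = (case vs of [u, v] \<Rightarrow> u \<bullet> v | _ \<Rightarrow> 0)"

definition levi_civita :: tensor where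
  "levi_civita vs = (case vs of [u, v] \<Rightarrow> det (vector [u, v] :: real^2^2) | _ \<Rightarrow> 0)"

definition cross :: "nat \<Rightarrow> nat \<Rightarrow> tensor \<Rightarrow> tensor \<Rightarrow> tensor" where
  "cross m n S T = (\<lambda>vs. - symmetrize (m + n - 2)
     (contract 1 m n (contract 1 m 2 S levi_civita) T) vs)"

definition laplacian :: "(real^2 \<Rightarrow> real) \<Rightarrow> real^2 \<Rightarrow> real" where
  "laplacian f x = (\<Sum>b\<in>Basis. (deriv ^^ 2) (\<lambda>t. f (x + t *\<^sub>R b)) 0)"

definition homogeneous_harmonic :: "nat \<Rightarrow> (real^2 \<Rightarrow> real) \<Rightarrow> bool" where
  "homogeneous_harmonic d h \<longleftrightarrow> real_polynomial_function h \<and>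
     (\<forall>c x. h (c *\<^sub>R x) = c ^ d * h x) \<and> (\<forall>x. laplacian h x = 0)"

definition harmonic_decomposition :: "nat \<Rightarrow> (real^2 \<Rightarrow> real) \<Rightarrow> (nat \<Rightarrow> real^2 \<Rightarrow> real) \<Rightarrow> bool" where
  "harmonic_decomposition n f h \<longleftrightarrow>
     (\<forall>k \<le> n div 2. homogeneous_harmonic (n - 2 * k) (h k)) \<and>
     (\<forall>x. f x = (\<Sum>k \<le> n div 2. ((x $ 1)\<^sup>2 + (x $ 2)\<^sup>2) ^ k * h k x))"

definition leading_harmonic :: "nat \<Rightarrow> tensor \<Rightarrow> tensor" where
  "leading_harmonic n S = (THE T. T \<in> sym_tensors n \<and>
     (\<exists>h. harmonic_decomposition n (phi n S) h \<and> phi n T = h 0))"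

definition plane_to_complex :: "real^2 \<Rightarrow> complex" where
  "plane_to_complex x = Complex (x $ 1) (x $ 2)"

end

theory Submission
  imports Defs
begin

text \<open>
  Identify the plane with the complex numbers by \<open>\<zeta> = x\<^sub>1 + \<i> x\<^sub>2\<close>. A symmetric tensor is determined by
  its polynomial (polarization, \<open>sym_tensor_eqI\<close>), so a harmonic tensor with polynomial
  \<open>Re (cnj a \<zeta>\<^sup>n)\<close> is the form \<open>v\<^sub>1, \<dots>, v\<^sub>n \<mapsto> Re (cnj a \<zeta> v\<^sub>1 \<dots> \<zeta> v\<^sub>n)\<close>, here called
  \<open>harmonic_form n a\<close>. All four formulas then reduce to complex arithmetic with the coefficients.

  Products: \<open>Re u Re v = (Re (u v) + Re (cnj u v)) / 2\<close>, and if \<open>u\<close> and \<open>v\<close> are multiples of positive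
  powers of \<open>\<zeta>\<close>, the second summand is divisible by \<open>\<zeta> cnj \<zeta> = x\<^sub>1\<^sup>2 + x\<^sub>2\<^sup>2\<close>. So the leading harmonic part of
  a symmetric product of \<open>k\<close> harmonic tensors has the coefficient \<open>2\<^sup>1\<^sup>-\<^sup>k z\<^sub>1 \<dots> z\<^sub>k\<close>
  (\<open>leading_harmonic_sym_prods\<close>). That this decomposition is the only one, as needed to evaluate the
  leading part, follows from the maximum principle (\<open>leading_harmonic_part_unique\<close>).

  Contraction: summing over basis vectors with \<open>\<zeta> = 1, \<i>\<close>, the products without conjugation cancel
  because \<open>1\<^sup>2 + \<i>\<^sup>2 = 0\<close>, and the others give \<open>2\<close> for each contracted index. Hence the full
  contraction of the forms with coefficients \<open>a\<close> of order \<open>m\<close> and \<open>b\<close> of order \<open>n \<ge> m\<close> has the polynomial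
  \<open>2\<^sup>m\<^sup>-\<^sup>1 Re (a cnj b \<zeta>\<^sup>n\<^sup>-\<^sup>m)\<close> (\<open>phi_contract_harmonic_form\<close>). This is the formula for the real part.

  Imaginary part: the cross product with the identity turns \<open>a\<close> into \<open>\<i> a\<close>
  (\<open>phi_id_cross_harmonic_form\<close>), which gives the two formulas of this kind from the one for the real
  part. The cross product of two harmonic forms is, up to a binomial coefficient, the sum of the products
  \<open>Im (a cnj b \<dots>)\<close> in which \<open>m - 1\<close> of the arguments are conjugated (\<open>cross_harmonic_form\<close>); each trace
  removes one conjugated and one other argument and multiplies by \<open>4\<close>
  (\<open>tensor_trace_mixed_form\<close>), and the binomial coefficient is the quotient of factorials in the theorem.
\<close>

section \<open>Symmetric tensors are determined by their polynomials\<close>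

lemma tensors_zero: "T \<in> tensors n \<Longrightarrow> length vs \<noteq> n \<Longrightarrow> T vs = 0"
  by (simp add: tensors_def)

lemma tensors_linear:
  "T \<in> tensors n \<Longrightarrow> length vs = n \<Longrightarrow> i < n \<Longrightarrow> linear (\<lambda>v. T (vs[i := v]))"
  by (simp add: tensors_def)

lemma sym_tensors_tensors: "T \<in> sym_tensors n \<Longrightarrow> T \<in> tensors n"
  by (simp add: sym_tensors_def)

lemma sym_tensors_mset:
  assumes "T \<in> sym_tensors n" "mset us = mset vs"
  shows "T us = T vs"
proof (cases "length vs = n")
  case True
  obtain \<sigma> where "\<sigma> permutes {..<length vs}" "permute_list \<sigma> vs = us"
    using assms(2) mset_eq_permutation by metis
  with True assms(1) show ?thesis by (auto simp: sym_tensors_def)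
next
  case False
  with assms show ?thesis
    using tensors_zero[OF sym_tensors_tensors[OF assms(1)]] mset_eq_length[OF assms(2)] by simp
qed

lemma sym_tensorsI:
  assumes "T \<in> tensors n" "\<And>us vs. mset us = mset vs \<Longrightarrow> length vs = n \<Longrightarrow> T us = T vs"
  shows "T \<in> sym_tensors n"
  using assms mset_permute_list unfolding sym_tensors_def by blast

lemma slice_sym_tensors:
  assumes "T \<in> sym_tensors (Suc n)"
  shows "(\<lambda>vs. T (v # vs)) \<in> sym_tensors n"
proof (rule sym_tensorsI)
  show "(\<lambda>vs. T (v # vs)) \<in> tensors n"
    using tensors_linear[OF sym_tensors_tensors[OF assms], of "v # _" "Suc _"]
      tensors_zero[OF sym_tensors_tensors[OF assms]]
    by (auto simp: tensors_def)
  show "T (v # us) = T (v # vs)" if "mset us = mset vs" for us vs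
    using sym_tensors_mset[OF assms] that by simp
qed

lemma tensors_linear_Cons:
  assumes "T \<in> tensors (Suc n)"
  shows "linear (\<lambda>v. T (v # vs))"
proof (cases "length vs = n")
  case True
  then show ?thesis using tensors_linear[OF assms, of "0 # vs" 0] by simp
next
  case False
  then show ?thesis
    using tensors_zero[OF assms] by (auto intro!: linearI)
qed

text \<open>
  Multilinear expansion of the diagonal along a line. Only the two lowest coefficients are recorded,
  since comparing coefficients of \<open>t\<close> is all that polarization uses.
\<close>

lemma phi_along_line:
  assumes "T \<in> sym_tensors n"
  shows "\<exists>P. (\<forall>t. phi n T (x + t *\<^sub>R v) = poly P t) \<and> coeff P 0 = phi n T x \<and>
           coeff P 1 = n * T (v # replicate (n - 1) x)"
  using assms
proof (induction n arbitrary: T)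
  case 0
  show ?case by (rule exI[of _ "[:T []:]"]) (simp add: phi_def)
next
  case (Suc n)
  obtain P where P: "\<And>t. phi n (\<lambda>vs. T (x # vs)) (x + t *\<^sub>R v) = poly P t"
    "coeff P 0 = phi n (\<lambda>vs. T (x # vs)) x"
    "coeff P 1 = n * T (x # v # replicate (n - 1) x)"
    using Suc.IH[OF slice_sym_tensors[OF Suc.prems, of x]] by auto
  obtain Q where Q: "\<And>t. phi n (\<lambda>vs. T (v # vs)) (x + t *\<^sub>R v) = poly Q t"
    "coeff Q 0 = phi n (\<lambda>vs. T (v # vs)) x"
    using Suc.IH[OF slice_sym_tensors[OF Suc.prems, of v]] by auto
  have "phi (Suc n) T (x + t *\<^sub>R v) = poly (P + pCons 0 Q) t" for t
  proof -
    have "linear (\<lambda>w. T (w # replicate n (x + t *\<^sub>R v)))"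
      by (rule tensors_linear_Cons[OF sym_tensors_tensors[OF Suc.prems]])
    from linear_add[OF this, of x "t *\<^sub>R v"] linear_scale[OF this, of t v]
    show ?thesis using P(1)[of t] Q(1)[of t] by (simp add: phi_def)
  qed
  moreover have "n * T (x # v # replicate (n - 1) x) = n * T (v # replicate n x)"
    by (cases n) (auto intro!: sym_tensors_mset[OF Suc.prems])
  ultimately show ?case
    using P Q by (intro exI[of _ "P + pCons 0 Q"]) (auto simp: phi_def algebra_simps)
qed

text \<open>
  Polarization: differentiating the polynomial in the direction \<open>v\<close> recovers the polynomial of the
  slice with \<open>v\<close> in the first argument, so induction on the order recovers all values.
\<close>

lemma sym_tensor_zero_if_phi_zero:
  assumes "T \<in> sym_tensors n" "\<And>x. phi n T x = 0"
  shows "T vs = 0"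
  using assms
proof (induction n arbitrary: T vs)
  case 0
  then show ?case
    using tensors_zero[OF sym_tensors_tensors[OF "0.prems"(1)], of vs]
    by (cases vs) (auto simp: phi_def)
next
  case (Suc n)
  show ?case
  proof (cases vs)
    case Nil
    then show ?thesis using tensors_zero[OF sym_tensors_tensors[OF Suc.prems(1)], of vs] by simp
  next
    case (Cons v us)
    have "phi n (\<lambda>vs. T (v # vs)) x = 0" for x
    proof -
      obtain P where P: "\<And>t. phi (Suc n) T (x + t *\<^sub>R v) = poly P t"
        "coeff P 1 = Suc n * T (v # replicate n x)"
        using phi_along_line[OF Suc.prems(1), of x v] by auto
      have "P = 0" using P(1) Suc.prems(2) by (intro poly_all_0_iff_0[THEN iffD1]) simp
      then show ?thesis using P(2) by (simp add: phi_def)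
    qed
    then show ?thesis
      using Suc.IH[OF slice_sym_tensors[OF Suc.prems(1)], of v us] Cons by simp
  qed
qed

lemma sym_tensor_eqI:
  assumes S: "S \<in> sym_tensors n" and T: "T \<in> sym_tensors n" and phi: "\<And>x. phi n S x = phi n T x"
  shows "S = T"
proof
  fix vs
  have "(\<lambda>vs. S vs - T vs) \<in> sym_tensors n"
    using S T by (auto simp: sym_tensors_def tensors_def intro!: linear_compose_sub)
  from sym_tensor_zero_if_phi_zero[OF this, of vs] phi show "S vs = T vs"
    by (simp add: phi_def)
qed

section \<open>Tensor operations\<close>

lemma phi_symmetrize: "phi n (symmetrize n T) x = phi n T x"
proof -
  have "permute_list \<sigma> (replicate n x) = replicate n x" if "\<sigma> permutes {..<n}" for \<sigma>
    by (rule nth_equalityI) (use permutes_in_image[OF that] in \<open>auto simp: permute_list_def\<close>)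
  then show ?thesis
    by (simp add: phi_def symmetrize_def card_permutations[of "{..<n}" n])
qed

lemma symmetrize_sym_tensors:
  assumes "T \<in> tensors n"
  shows "symmetrize n T \<in> sym_tensors n"
proof -
  have "linear (\<lambda>v. symmetrize n T (vs[i := v]))" if "length vs = n" "i < n" for vs i
  proof -
    have lin: "linear (\<lambda>v. T (permute_list \<sigma> (vs[i := v])))" if "\<sigma> permutes {..<n}" for \<sigma>
    proof -
      have j: "inv \<sigma> i < n"
        using permutes_in_image[OF permutes_inv[OF that], of i] \<open>i < n\<close> by simp
      have "permute_list \<sigma> (vs[i := v]) = (permute_list \<sigma> vs)[inv \<sigma> i := v]" for v
      proof (rule nth_equalityI)
        fix k assume "k < length (permute_list \<sigma> (vs[i := v]))"
        moreover from this have "\<sigma> k < n"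
          using permutes_in_image[OF that, of k] \<open>length vs = n\<close> by simp
        moreover have "\<sigma> k = i \<longleftrightarrow> inv \<sigma> i = k"
          using permutes_inv_eq[OF that] by metis
        ultimately show "permute_list \<sigma> (vs[i := v]) ! k = (permute_list \<sigma> vs)[inv \<sigma> i := v] ! k"
          using \<open>length vs = n\<close> \<open>i < n\<close> j by (auto simp: permute_list_def nth_list_update)
      qed simp
      then show ?thesis
        using tensors_linear[OF assms, of "permute_list \<sigma> vs", OF _ j] \<open>length vs = n\<close> by simp
    qed
    have "linear (\<lambda>v. \<Sum>\<sigma> | \<sigma> permutes {..<n}. T (permute_list \<sigma> (vs[i := v])))"
      by (rule linear_compose_sum) (use lin in auto)
    then have "linear (\<lambda>v. (1 / fact n) *\<^sub>R
        (\<Sum>\<sigma> | \<sigma> permutes {..<n}. T (permute_list \<sigma> (vs[i := v]))))"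
      by (rule linear_compose_scale_right)
    then show ?thesis using that by (simp add: symmetrize_def)
  qed
  moreover have "symmetrize n T (permute_list \<sigma> vs) = symmetrize n T vs"
    if "\<sigma> permutes {..<n}" "length vs = n" for \<sigma> vs
  proof -
    have "(\<Sum>\<tau> | \<tau> permutes {..<n}. T (permute_list \<tau> (permute_list \<sigma> vs))) =
        (\<Sum>\<tau> | \<tau> permutes {..<n}. T (permute_list (\<sigma> \<circ> \<tau>) vs))"
      by (rule sum.cong) (use that in \<open>auto simp: permute_list_compose\<close>)
    also have "\<dots> = (\<Sum>\<tau> | \<tau> permutes {..<n}. T (permute_list \<tau> vs))"
      by (rule setum_permutations_compose_left[OF that(1), symmetric])
    finally show ?thesis using that by (simp add: symmetrize_def)
  qed
  ultimately show ?thesis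
    by (auto simp: sym_tensors_def tensors_def symmetrize_def)
qed

lemma contract_tensors:
  assumes S: "S \<in> tensors m" and T: "T \<in> tensors n" and "r \<le> m" "r \<le> n"
  shows "contract r m n S T \<in> tensors (m - r + (n - r))"
proof -
  have "linear (\<lambda>v. contract r m n S T (vs[i := v]))"
    if len: "length vs = m - r + (n - r)" and i: "i < m - r + (n - r)" for vs i
  proof -
    have "linear (\<lambda>v. S (take (m - r) (vs[i := v]) @ ks) * T (ks @ drop (m - r) (vs[i := v])))"
      if "length ks = r" for ks
    proof (cases "i < m - r")
      case True
      have "linear (\<lambda>v. T (ks @ drop (m - r) vs) *\<^sub>R S ((take (m - r) vs @ ks)[i := v]))"
        by (intro linear_compose_scale_right tensors_linear[OF S])
          (use True len that assms in auto)
      then show ?thesis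
        using True len by (simp add: take_update_swap list_update_append mult.commute)
    next
      case False
      then obtain k where k: "i = m - r + k" by (metis le_Suc_ex not_less)
      have "linear (\<lambda>v. S (take (m - r) vs @ ks) *\<^sub>R T ((ks @ drop (m - r) vs)[r + k := v]))"
        by (intro linear_compose_scale_right tensors_linear[OF T])
          (use k len i that assms in auto)
      then show ?thesis
        using k that by (simp add: drop_update_swap list_update_append)
    qed
    then show ?thesis
      using len by (auto simp: contract_def intro!: linear_compose_sum)
  qed
  then show ?thesis by (auto simp: tensors_def contract_def)
qed

lemma contract_one:
  assumes "length vs = (m - 1) + (n - 1)"
  shows "contract 1 m n S T vs =
    (\<Sum>b\<in>Basis. S (take (m - 1) vs @ [b]) * T (b # drop (m - 1) vs))"
proof -
  have "{ks. set ks \<subseteq> (Basis :: (real^2) set) \<and> length ks = 1} = (\<lambda>b. [b]) ` Basis"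
    by (auto simp: length_Suc_conv)
  then show ?thesis
    using assms by (simp add: contract_def sum.reindex inj_on_def)
qed

lemma levi_civita_tensors: "levi_civita \<in> tensors 2"
proof -
  have "linear (\<lambda>v. levi_civita (vs[i := v]))" if "length vs = 2" "i < 2" for vs i
    using that
    by (auto simp: levi_civita_def numeral_2_eq_2 length_Suc_conv less_Suc_eq det_2 algebra_simps
        intro!: linearI)
  then show ?thesis
    by (auto simp: tensors_def levi_civita_def numeral_2_eq_2 split: list.splits)
qed

lemma cross_sym_tensors:
  assumes "S \<in> tensors m" "T \<in> tensors n" "m \<ge> 1" "n \<ge> 1"
  shows "cross m n S T \<in> sym_tensors (m + n - 2)"
proof -
  have "contract 1 m 2 S levi_civita \<in> tensors m"
    using contract_tensors[OF assms(1) levi_civita_tensors, of 1] assms by simp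
  then have "contract 1 m n (contract 1 m 2 S levi_civita) T \<in> tensors (m - 1 + (n - 1))"
    by (rule contract_tensors) (use assms in auto)
  also have "m - 1 + (n - 1) = m + n - 2" using assms by simp
  finally have "symmetrize (m + n - 2) (contract 1 m n (contract 1 m 2 S levi_civita) T)
      \<in> sym_tensors (m + n - 2)"
    by (rule symmetrize_sym_tensors)
  then show ?thesis
    by (auto simp: cross_def sym_tensors_def tensors_def intro!: linear_compose_neg)
qed

lemma Basis_plane: "(Basis :: (real^2) set) = {axis 1 1, axis 2 1}"
  by (auto simp: Basis_vec_def UNIV_2)

lemma sum_Basis_plane: "(\<Sum>b\<in>(Basis :: (real^2) set). f b) = f (axis 1 1) + f (axis 2 1)"
  by (simp add: Basis_plane axis_eq_axis)

lemma phi_cross: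
  assumes "m \<ge> 1" "n \<ge> 1"
  shows "phi (m + n - 2) (cross m n S T) x =
    S (replicate (m - 1) x @ [axis 2 1]) * T (axis 1 1 # replicate (n - 1) x) -
    S (replicate (m - 1) x @ [axis 1 1]) * T (axis 2 1 # replicate (n - 1) x)"
proof -
  have eps: "contract 1 m 2 S levi_civita (replicate (m - 1) x @ [b]) =
      S (replicate (m - 1) x @ [axis 1 1]) * b $ 2 - S (replicate (m - 1) x @ [axis 2 1]) * b $ 1" for b
    using assms by (subst contract_one) (auto simp: sum_Basis_plane levi_civita_def det_2 axis_def)
  have "phi (m + n - 2) (cross m n S T) x =
      - phi (m + n - 2) (contract 1 m n (contract 1 m 2 S levi_civita) T) x"
    unfolding cross_def using phi_symmetrize by (simp add: phi_def)
  also have "\<dots> = - (\<Sum>b\<in>Basis. contract 1 m 2 S levi_civita (replicate (m - 1) x @ [b]) *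
      T (b # replicate (n - 1) x))"
    unfolding phi_def by (subst contract_one) (use assms in \<open>auto simp: min_def\<close>)
  also have "\<dots> = S (replicate (m - 1) x @ [axis 2 1]) * T (axis 1 1 # replicate (n - 1) x) -
      S (replicate (m - 1) x @ [axis 1 1]) * T (axis 2 1 # replicate (n - 1) x)"
    unfolding sum_Basis_plane eps by (simp add: axis_def)
  finally show ?thesis .
qed

section \<open>Uniqueness of the leading harmonic part\<close>

text \<open>
  Restricted to lines, polynomial functions are polynomials of one variable, which makes the second
  derivatives in the Laplacian computable as \<^const>\<open>pderiv\<close>.
\<close>

lemma real_polynomial_function_on_line:
  assumes "real_polynomial_function f"
  obtains P where "(\<lambda>t. f (x + t *\<^sub>R b)) = poly P"
proof -
  have "\<exists>P. \<forall>t. f (x + t *\<^sub>R b) = poly P t"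
    using assms
  proof induction
    case (linear f)
    then interpret bounded_linear f .
    show ?case by (rule exI[of _ "[:f x, f b:]"]) (simp add: add scaleR)
  next
    case (const c)
    show ?case by (rule exI[of _ "[:c:]"]) simp
  next
    case (add f g)
    then obtain P Q where "\<forall>t. f (x + t *\<^sub>R b) = poly P t" "\<forall>t. g (x + t *\<^sub>R b) = poly Q t"
      by blast
    then show ?case by (intro exI[of _ "P + Q"]) simp
  next
    case (mult f g)
    then obtain P Q where "\<forall>t. f (x + t *\<^sub>R b) = poly P t" "\<forall>t. g (x + t *\<^sub>R b) = poly Q t"
      by blast
    then show ?case by (intro exI[of _ "P * Q"]) simp
  qed
  then show ?thesis using that by (auto simp: fun_eq_iff)
qed

lemma second_deriv_poly: "(deriv ^^ 2) (poly P) t = poly (pderiv (pderiv P)) (t :: real)"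
proof -
  have "deriv (poly Q) = poly (pderiv Q)" for Q :: "real poly"
    by (rule ext, rule DERIV_imp_deriv, rule poly_DERIV)
  then show ?thesis by (simp add: numeral_2_eq_2)
qed

lemma laplacian_linear_combination:
  assumes "real_polynomial_function f" "real_polynomial_function g"
  shows "laplacian (\<lambda>x. c * f x + d * g x) x = c * laplacian f x + d * laplacian g x"
proof -
  have "(deriv ^^ 2) (\<lambda>t. c * f (x + t *\<^sub>R b) + d * g (x + t *\<^sub>R b)) 0 =
      c * (deriv ^^ 2) (\<lambda>t. f (x + t *\<^sub>R b)) 0 + d * (deriv ^^ 2) (\<lambda>t. g (x + t *\<^sub>R b)) 0" for b
  proof -
    obtain P where P: "(\<lambda>t. f (x + t *\<^sub>R b)) = poly P"
      by (rule real_polynomial_function_on_line[OF assms(1)])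
    obtain Q where Q: "(\<lambda>t. g (x + t *\<^sub>R b)) = poly Q"
      by (rule real_polynomial_function_on_line[OF assms(2)])
    have "(\<lambda>t. c * f (x + t *\<^sub>R b) + d * g (x + t *\<^sub>R b)) = poly (smult c P + smult d Q)"
      using P Q by (auto simp: fun_eq_iff)
    then show ?thesis
      unfolding P Q by (simp only: second_deriv_poly) (simp add: pderiv_add pderiv_smult)
  qed
  then show ?thesis by (simp add: laplacian_def sum.distrib sum_distrib_left)
qed

lemma laplacian_sum_eq_zero:
  assumes "finite K" "\<And>k. k \<in> K \<Longrightarrow> real_polynomial_function (f k)"
    "\<And>k. k \<in> K \<Longrightarrow> laplacian (f k) x = 0"
  shows "laplacian (\<lambda>x. \<Sum>k\<in>K. f k x) x = 0"
  using assms
proof (induction K rule: finite_induct)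
  case empty
  have "laplacian (\<lambda>x. 0 * (0 :: real) + 0 * 0) x = 0"
    by (subst laplacian_linear_combination) (auto intro: real_polynomial_function.intros(2))
  then show ?case by simp
next
  case (insert k K)
  have "laplacian (\<lambda>x. 1 * f k x + 1 * (\<Sum>k\<in>K. f k x)) x = 0"
    by (subst laplacian_linear_combination) (use insert in auto)
  then show ?case using insert by simp
qed

lemma real_polynomial_function_nth: "real_polynomial_function (\<lambda>x :: real^2. x $ i)"
  by (intro real_polynomial_function.intros(1) bounded_linear_vec_nth)

lemma norm_square_plane: "(x $ 1)\<^sup>2 + (x $ 2)\<^sup>2 = (norm (x :: real^2))\<^sup>2"
  unfolding power2_norm_eq_inner by (simp add: inner_vec_def sum_2 power2_eq_square)

lemma laplacian_norm_square: "laplacian (\<lambda>x. (x $ 1)\<^sup>2 + (x $ 2)\<^sup>2) x = 4"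
proof -
  have "(\<lambda>t. ((x + t *\<^sub>R axis 1 1) $ 1)\<^sup>2 + ((x + t *\<^sub>R axis 1 1) $ 2)\<^sup>2) =
      poly [:(x $ 1)\<^sup>2 + (x $ 2)\<^sup>2, 2 * x $ 1, 1:]"
    "(\<lambda>t. ((x + t *\<^sub>R axis 2 1) $ 1)\<^sup>2 + ((x + t *\<^sub>R axis 2 1) $ 2)\<^sup>2) =
      poly [:(x $ 1)\<^sup>2 + (x $ 2)\<^sup>2, 2 * x $ 2, 1:]"
    by (auto simp: fun_eq_iff axis_def algebra_simps power2_eq_square)
  then show ?thesis
    unfolding laplacian_def sum_Basis_plane by (simp only: second_deriv_poly) (simp add: pderiv_pCons)
qed

lemma second_derivative_nonpos_at_max:
  fixes P :: "real poly"
  assumes "e > 0" "\<And>t. \<bar>t\<bar> < e \<Longrightarrow> poly P t \<le> poly P 0"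
  shows "poly (pderiv (pderiv P)) 0 \<le> 0"
proof (rule ccontr)
  assume "\<not> ?thesis"
  then have pos: "poly (pderiv (pderiv P)) 0 > 0" by simp
  have "poly (pderiv P) 0 = 0"
    by (rule DERIV_local_max[OF poly_DERIV assms(1)]) (use assms(2) in auto)
  with DERIV_pos_inc_right[OF poly_DERIV pos]
  obtain d where d: "d > 0" "\<And>h. 0 < h \<Longrightarrow> h < d \<Longrightarrow> poly (pderiv P) h > 0"
    by auto
  define h where "h = min d e / 2"
  have h: "0 < h" "h < d" "h < e" using d(1) assms(1) by (auto simp: h_def min_def)
  obtain \<xi> where "0 < \<xi>" "\<xi> < h" "poly P h - poly P 0 = (h - 0) * poly (pderiv P) \<xi>"
    using MVT2[OF h(1), of "poly P" "poly (pderiv P)"] poly_DERIV by auto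
  moreover from this d(2)[of \<xi>] h have "h * poly (pderiv P) \<xi> > 0" by simp
  ultimately have "poly P h > poly P 0" by simp
  with assms(2)[of h] h show False by simp
qed

text \<open>
  The maximum principle. Adding \<open>\<epsilon> (x\<^sub>1\<^sup>2 + x\<^sub>2\<^sup>2)\<close> makes the Laplacian strictly positive, which excludes
  an interior maximum by the second derivative test; then \<open>\<epsilon>\<close> tends to zero.
\<close>

lemma harmonic_nonpos_on_disc:
  assumes poly: "real_polynomial_function f" and harm: "\<And>x. laplacian f x = 0"
    and circle: "\<And>x. norm x = 1 \<Longrightarrow> f x \<le> 0" and x: "norm x \<le> 1"
  shows "f x \<le> 0"
proof (rule field_le_epsilon)
  fix \<epsilon> :: real assume \<epsilon>: "\<epsilon> > 0"
  define q :: "real^2 \<Rightarrow> real" where "q = (\<lambda>x. (x $ 1)\<^sup>2 + (x $ 2)\<^sup>2)"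
  have q: "q x = (norm x)\<^sup>2" for x
    by (simp add: q_def norm_square_plane)
  have q_poly: "real_polynomial_function q"
    unfolding q_def
    by (intro real_polynomial_function.intros(3) real_polynomial_function_power real_polynomial_function_nth)
  define g where "g = (\<lambda>x. 1 * f x + \<epsilon> * q x)"
  have g_poly: "real_polynomial_function g"
    unfolding g_def by (intro real_polynomial_function.intros(2-4) poly q_poly)
  have lap_g: "laplacian g x = 4 * \<epsilon>" for x
    unfolding g_def using laplacian_linear_combination[OF poly q_poly, of 1 \<epsilon> x] harm
      laplacian_norm_square by (simp add: q_def)
  have "continuous_on (cball 0 1) g"
    using g_poly continuous_on_polymonial_function real_polynomial_function_eq by blast
  then obtain m where m: "m \<in> cball 0 1" "\<And>y. y \<in> cball 0 1 \<Longrightarrow> g y \<le> g m"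
    using continuous_attains_sup[of "cball (0 :: real^2) 1" g] by auto
  have "norm m = 1"
  proof (rule ccontr)
    assume "norm m \<noteq> 1"
    with m(1) have e: "1 - norm m > 0" by simp
    have "(deriv ^^ 2) (\<lambda>t. g (m + t *\<^sub>R b)) 0 \<le> 0" if "b \<in> Basis" for b
    proof -
      obtain P where P: "(\<lambda>t. g (m + t *\<^sub>R b)) = poly P"
        by (rule real_polynomial_function_on_line[OF g_poly])
      have "poly P t \<le> poly P 0" if "\<bar>t\<bar> < 1 - norm m" for t
      proof -
        have "norm (m + t *\<^sub>R b) \<le> 1"
          using norm_triangle_ineq[of m "t *\<^sub>R b"] that \<open>b \<in> Basis\<close> by simp
        then have "g (m + t *\<^sub>R b) \<le> g m" using m(2) by simp
        then show ?thesis using fun_cong[OF P, of t] fun_cong[OF P, of 0] by simp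
      qed
      from second_derivative_nonpos_at_max[OF e this] show ?thesis
        unfolding P second_deriv_poly .
    qed
    then have "laplacian g m \<le> 0" unfolding laplacian_def by (rule sum_nonpos)
    with lap_g \<epsilon> show False by simp
  qed
  then have "g m \<le> \<epsilon>" using circle by (simp add: g_def q)
  moreover have "f x \<le> g x" using \<epsilon> by (simp add: g_def q)
  moreover have "g x \<le> g m" using m(2) x by simp
  ultimately show "f x \<le> 0 + \<epsilon>" by simp
qed

lemma harmonic_zero_on_disc:
  assumes poly: "real_polynomial_function f" and harm: "\<And>x. laplacian f x = 0"
    and circle: "\<And>x. norm x = 1 \<Longrightarrow> f x = 0" and x: "norm x \<le> 1"
  shows "f x = 0"
proof -
  have "real_polynomial_function (\<lambda>x. - f x)"
    using poly by auto
  moreover have "laplacian (\<lambda>x. - f x) x = 0" for x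
    using laplacian_linear_combination[OF poly poly, of "-1" 0 x] harm by simp
  ultimately have "- f x \<le> 0"
    by (rule harmonic_nonpos_on_disc) (use circle x in auto)
  moreover have "f x \<le> 0"
    by (rule harmonic_nonpos_on_disc) (use assms in auto)
  ultimately show ?thesis by simp
qed

text \<open>
  On the unit circle the powers of \<open>x\<^sub>1\<^sup>2 + x\<^sub>2\<^sup>2\<close> disappear, so the difference of two decompositions of
  the same polynomial becomes a sum of harmonic functions vanishing there. By the maximum principle
  it vanishes on the disc, and the parts of different degree are separated by scaling.
\<close>

lemma leading_harmonic_part_unique:
  assumes g: "harmonic_decomposition n f g" and h: "harmonic_decomposition n f h"
  shows "g 0 = h 0"
proof
  fix x :: "real^2"
  define d where "d k x = g k x - h k x" for k x
  have hh: "homogeneous_harmonic (n - 2 * k) (d k)" if "k \<le> n div 2" for k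
  proof -
    have "homogeneous_harmonic (n - 2 * k) (g k)" "homogeneous_harmonic (n - 2 * k) (h k)"
      using g h that by (auto simp: harmonic_decomposition_def)
    then have *: "real_polynomial_function (g k)" "real_polynomial_function (h k)"
      "\<And>x. laplacian (g k) x = 0" "\<And>x. laplacian (h k) x = 0"
      "\<And>c x. g k (c *\<^sub>R x) = c ^ (n - 2 * k) * g k x"
      "\<And>c x. h k (c *\<^sub>R x) = c ^ (n - 2 * k) * h k x"
      by (auto simp: homogeneous_harmonic_def)
    have "laplacian (d k) x = 0" for x
      using laplacian_linear_combination[OF *(1,2), of 1 "-1" x] *(3,4)[of x] by (simp add: d_def[abs_def])
    with * show ?thesis
      by (auto simp: homogeneous_harmonic_def d_def[abs_def] algebra_simps)
  qed
  define F where "F x = (\<Sum>k\<le>n div 2. d k x)" for x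
  have disc: "F x = 0" if "norm x \<le> 1" for x
  proof (rule harmonic_zero_on_disc[OF _ _ _ that])
    show "real_polynomial_function F"
      unfolding F_def[abs_def] using hh
      by (intro real_polynomial_function_sum) (auto simp: homogeneous_harmonic_def)
    show "laplacian F x = 0" for x
      unfolding F_def[abs_def] using hh
      by (intro laplacian_sum_eq_zero) (auto simp: homogeneous_harmonic_def)
    show "F x = 0" if "norm x = 1" for x
    proof -
      have "f x = (\<Sum>k\<le>n div 2. ((x $ 1)\<^sup>2 + (x $ 2)\<^sup>2) ^ k * g k x)"
        "f x = (\<Sum>k\<le>n div 2. ((x $ 1)\<^sup>2 + (x $ 2)\<^sup>2) ^ k * h k x)"
        using g h unfolding harmonic_decomposition_def by blast+
      then have "(\<Sum>k\<le>n div 2. g k x) = (\<Sum>k\<le>n div 2. h k x)"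
        by (simp add: norm_square_plane that)
      then show ?thesis by (simp add: F_def d_def sum_subtractf)
    qed
  qed
  have circle: "d 0 u = 0" if "norm u = 1" for u
  proof -
    define P where "P = (\<Sum>k\<le>n div 2. monom (d k u) (n - 2 * k))"
    have "poly P c = 0" if "c \<in> {0..1}" for c
    proof -
      have "poly P c = F (c *\<^sub>R u)"
        using hh by (auto simp: P_def F_def poly_sum poly_monom homogeneous_harmonic_def intro!: sum.cong)
      also have "\<dots> = 0" by (rule disc) (use that \<open>norm u = 1\<close> in simp)
      finally show ?thesis .
    qed
    then have "{0..1 :: real} \<subseteq> {c. poly P c = 0}" by auto
    from finite_subset[OF this] have "P = 0"
      using poly_roots_finite[of P] infinite_Icc[of 0 "1 :: real"] by argo
    then have "0 = coeff P n" by simp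
    also have "\<dots> = (\<Sum>k\<le>n div 2. if k = 0 then d k u else 0)"
      unfolding P_def coeff_sum by (rule sum.cong) auto
    also have "\<dots> = d 0 u" by (simp add: sum.delta)
    finally show ?thesis by simp
  qed
  obtain u where u: "norm u = 1" "x = norm x *\<^sub>R u"
  proof (cases "x = 0")
    case True
    then show ?thesis using that[of "axis 1 1"] by simp
  next
    case False
    then show ?thesis using that[of "x /\<^sub>R norm x"] by simp
  qed
  have "d 0 x = norm x ^ n * d 0 u"
    using hh[of 0] by (subst u(2)) (simp add: homogeneous_harmonic_def)
  with circle[OF u(1)] show "g 0 x = h 0 x" by (simp add: d_def)
qed

lemma leading_harmonic_eqI:
  assumes T: "T \<in> sym_tensors n" and h: "harmonic_decomposition n (phi n S) h" and phi: "phi n T = h 0"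
  shows "leading_harmonic n S = T"
  unfolding leading_harmonic_def
proof (rule the_equality)
  show "T \<in> sym_tensors n \<and> (\<exists>h. harmonic_decomposition n (phi n S) h \<and> phi n T = h 0)"
    using assms by blast
  show "U = T" if "U \<in> sym_tensors n \<and> (\<exists>g. harmonic_decomposition n (phi n S) g \<and> phi n U = g 0)" for U
    using that T phi leading_harmonic_part_unique[OF _ h] by (metis sym_tensor_eqI)
qed

section \<open>Tensors in complex notation\<close>

abbreviation (input) \<zeta> :: "real^2 \<Rightarrow> complex" where "\<zeta> \<equiv> plane_to_complex"

text \<open>
  The polarized form of the harmonic polynomial \<open>Re (cnj a * \<zeta>\<^sup>n)\<close>.
\<close>

definition harmonic_form :: "nat \<Rightarrow> complex \<Rightarrow> tensor" where
  "harmonic_form n a vs = (if length vs = n then Re (cnj a * prod_list (map \<zeta> vs)) else 0)"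

text \<open>
  The coefficient of \<open>t\<^sup>m\<close> in \<open>\<Prod>\<^sub>i (\<zeta> v\<^sub>i + t cnj (\<zeta> v\<^sub>i))\<close> is the sum, over all ways of conjugating
  \<open>m\<close> of the factors, of the product of the \<open>\<zeta> v\<^sub>i\<close>: up to scale the symmetrization of
  \<open>cnj (\<zeta> v\<^sub>1) \<dots> cnj (\<zeta> v\<^sub>m) \<zeta> v\<^sub>m\<^sub>+\<^sub>1 \<dots> \<zeta> v\<^sub>n\<close>. The generating polynomial makes both the symmetry and
  the traces of this tensor easy.
\<close>

definition mixed_form :: "nat \<Rightarrow> nat \<Rightarrow> complex \<Rightarrow> tensor" where
  "mixed_form n m c vs = (if length vs = n
     then Im (c * coeff (\<Prod>v\<leftarrow>vs. [:\<zeta> v, cnj (\<zeta> v):]) m) else 0)"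

lemma \<zeta>_add [simp]: "\<zeta> (u + v) = \<zeta> u + \<zeta> v"
  and \<zeta>_scale [simp]: "\<zeta> (r *\<^sub>R v) = of_real r * \<zeta> v"
  and \<zeta>_axis [simp]: "\<zeta> (axis 1 1) = 1" "\<zeta> (axis 2 1) = \<i>"
  by (simp_all add: plane_to_complex_def complex_eq_iff axis_def)

lemma Re_of_real_mult: "Re (of_real r * w) = r * Re w"
  and Im_of_real_mult: "Im (of_real r * w) = r * Im w"
  by simp_all

lemma \<zeta>_cnj: "\<zeta> x * cnj (\<zeta> x) = of_real ((x $ 1)\<^sup>2 + (x $ 2)\<^sup>2)"
  by (simp add: plane_to_complex_def complex_eq_iff power2_eq_square)

text \<open>
  A functional of a product with one factor for each argument is symmetric by commutativity, and
  multilinear if it is linear in each factor.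
\<close>

lemma sym_tensors_product:
  fixes g :: "real^2 \<Rightarrow> 'b::comm_monoid_mult"
  assumes "\<And>P. linear (\<lambda>v. F (P * g v))"
  shows "(\<lambda>vs. if length vs = n then F (\<Prod>v\<leftarrow>vs. g v) else 0) \<in> sym_tensors n"
proof (rule sym_tensorsI)
  have "linear (\<lambda>v. F (\<Prod>v\<leftarrow>vs[i := v]. g v))" if "i < length vs" for vs i
  proof -
    have "(\<Prod>v\<leftarrow>vs[i := v]. g v) =
        (\<Prod>v\<leftarrow>take i vs. g v) * (\<Prod>v\<leftarrow>drop (Suc i) vs. g v) * g v" for v
      using that by (simp add: upd_conv_take_nth_drop ac_simps)
    then show ?thesis using assms by simp
  qed
  then show "(\<lambda>vs. if length vs = n then F (\<Prod>v\<leftarrow>vs. g v) else 0) \<in> tensors n"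
    by (auto simp: tensors_def)
next
  fix us vs :: "(real^2) list"
  assume eq: "mset us = mset vs"
  then have "(\<Prod>v\<leftarrow>us. g v) = (\<Prod>v\<leftarrow>vs. g v)"
    by (metis mset_map prod_mset_prod_list)
  with mset_eq_length[OF eq]
  show "(if length us = n then F (\<Prod>v\<leftarrow>us. g v) else 0) =
      (if length vs = n then F (\<Prod>v\<leftarrow>vs. g v) else 0)"
    by simp
qed

lemma harmonic_form_sym_tensors: "harmonic_form n a \<in> sym_tensors n"
proof -
  have "linear (\<lambda>v. Re (cnj a * (P * \<zeta> v)))" for P
    by (rule linearI) (simp_all add: algebra_simps)
  from sym_tensors_product[of "\<lambda>u. Re (cnj a * u)" \<zeta>, OF this] show ?thesis
    by (simp add: harmonic_form_def[abs_def])
qed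

lemma mixed_form_sym_tensors: "mixed_form n m c \<in> sym_tensors n"
proof -
  have "linear (\<lambda>v. Im (c * coeff (P * [:\<zeta> v, cnj (\<zeta> v):]) m))" for P
    by (rule linearI) (cases m; simp add: algebra_simps coeff_pCons)+
  from sym_tensors_product[of "\<lambda>u. Im (c * coeff u m)" "\<lambda>v. [:\<zeta> v, cnj (\<zeta> v):]", OF this]
  show ?thesis by (simp add: mixed_form_def[abs_def])
qed

lemma phi_harmonic_form: "phi n (harmonic_form n a) x = Re (cnj a * \<zeta> x ^ n)"
  by (simp add: phi_def harmonic_form_def)

lemma phi_mixed_form:
  assumes "m \<le> n"
  shows "phi n (mixed_form n m c) x = (n choose m) * Im (c * cnj (\<zeta> x) ^ m * \<zeta> x ^ (n - m))"
proof -
  have "phi n (mixed_form n m c) x =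
      Im (of_nat (n choose m) * (c * cnj (\<zeta> x) ^ m * \<zeta> x ^ (n - m)))"
    using assms by (simp add: phi_def mixed_form_def coeff_linear_poly_power mult_ac)
  then show ?thesis by (simp del: mult_cancel_left)
qed

text \<open>
  Contracting two arguments leaves only the terms in which exactly one of them is conjugated, because
  \<open>1\<^sup>2 + \<i>\<^sup>2 = 0\<close>. There are two such choices, and each contributes \<open>\<bar>1\<bar>\<^sup>2 + \<bar>\<i>\<bar>\<^sup>2 = 2\<close>.
\<close>

lemma tensor_trace_mixed_form:
  "tensor_trace (mixed_form (n + 2) (Suc m) c) = mixed_form n m (4 * c)"
proof
  fix vs
  show "tensor_trace (mixed_form (n + 2) (Suc m) c) vs = mixed_form n m (4 * c) vs"
  proof (cases "length vs = n")
    case True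
    define P where "P = (\<Prod>v\<leftarrow>vs. [:\<zeta> v, cnj (\<zeta> v):])"
    have "tensor_trace (mixed_form (n + 2) (Suc m) c) vs =
        Im (c * coeff (([:1, 1:] * [:1, 1:] + [:\<i>, - \<i>:] * [:\<i>, - \<i>:]) * P) (Suc m))"
      using True
      by (simp add: tensor_trace_def mixed_form_def sum_Basis_plane P_def algebra_simps
          del: mult_pCons_left mult_pCons_right)
    also have "[:1, 1:] * [:1, 1:] + [:\<i>, - \<i>:] * [:\<i>, - \<i>:] = [:0, 4:]"
      by simp
    also have "Im (c * coeff ([:0, 4:] * P) (Suc m)) = mixed_form n m (4 * c) vs"
      using True by (simp add: mixed_form_def P_def)
    finally show ?thesis .
  qed (simp add: tensor_trace_def mixed_form_def)
qed

lemma tensor_trace_power_mixed_form: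
  "(tensor_trace ^^ m) (mixed_form (n + 2 * m) m c) = mixed_form n 0 (4 ^ m * c)"
proof (induction m arbitrary: c)
  case (Suc m)
  have "(tensor_trace ^^ Suc m) (mixed_form (n + 2 * Suc m) (Suc m) c) =
      (tensor_trace ^^ m) (tensor_trace (mixed_form (n + 2 * m + 2) (Suc m) c))"
    by (simp only: funpow_Suc_right o_def) (simp add: ac_simps)
  then show ?case unfolding tensor_trace_mixed_form Suc.IH by (simp add: mult_ac)
qed simp

section \<open>Contractions and cross products of harmonic tensors\<close>

lemma sum_words_prod:
  fixes g :: "'a \<Rightarrow> 'b::comm_semiring_1"
  shows "(\<Sum>ks | set ks \<subseteq> A \<and> length ks = r. \<Prod>k\<leftarrow>ks. g k) = (\<Sum>k\<in>A. g k) ^ r"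
proof (induction r)
  case 0
  have "{ks. set ks \<subseteq> A \<and> length ks = 0} = {[]}" by auto
  then show ?case by simp
next
  case (Suc r)
  let ?W = "\<lambda>r. {ks. set ks \<subseteq> A \<and> length ks = r}"
  have W: "?W (Suc r) = (\<lambda>(k, ks). k # ks) ` (A \<times> ?W r)"
    by (auto simp: length_Suc_conv image_iff)
  have "inj_on (\<lambda>(k, ks). k # ks) (A \<times> ?W r)" by (auto simp: inj_on_def)
  then have "(\<Sum>ks\<in>?W (Suc r). \<Prod>k\<leftarrow>ks. g k) = (\<Sum>(k, ks)\<in>A \<times> ?W r. g k * (\<Prod>k\<leftarrow>ks. g k))"
    unfolding W by (subst sum.reindex) (auto intro!: sum.cong)
  also have "\<dots> = (\<Sum>k\<in>A. g k) * (\<Sum>ks\<in>?W r. \<Prod>k\<leftarrow>ks. g k)"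
    by (simp add: sum_product sum.cartesian_product)
  finally show ?case using Suc.IH by simp
qed

text \<open>
  Writing \<open>Re u * Re v = (Re (u * v) + Re (cnj u * v)) / 2\<close> splits the sum over the contracted basis
  vectors into a part with \<open>(1\<^sup>2 + \<i>\<^sup>2)\<^sup>m = 0\<close> and one with \<open>(\<bar>1\<bar>\<^sup>2 + \<bar>\<i>\<bar>\<^sup>2)\<^sup>m = 2\<^sup>m\<close>.
\<close>

lemma phi_contract_harmonic_form:
  assumes "1 \<le> m" "m \<le> n"
  shows "phi (n - m) (contract m m n (harmonic_form m a) (harmonic_form n b)) x =
    2 ^ (m - 1) * Re (a * cnj b * \<zeta> x ^ (n - m))"
proof -
  let ?W = "{ks. set ks \<subseteq> (Basis :: (real^2) set) \<and> length ks = m}"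
  define u where "u = cnj b * \<zeta> x ^ (n - m)"
  have Re_mult: "Re (cnj a * p) * Re (p * u) =
      Re (cnj a * u * (p * p)) / 2 + Re (a * u * (cnj p * p)) / 2" for p
    by (simp add: algebra_simps add_divide_distrib diff_divide_distrib)
  have "phi (n - m) (contract m m n (harmonic_form m a) (harmonic_form n b)) x =
      (\<Sum>ks\<in>?W. Re (cnj a * prod_list (map \<zeta> ks)) * Re (prod_list (map \<zeta> ks) * u))"
    unfolding phi_def contract_def
    using assms by (auto simp: harmonic_form_def u_def mult_ac intro!: sum.cong)
  also have "\<dots> = Re (cnj a * u * (\<Sum>ks\<in>?W. \<Prod>k\<leftarrow>ks. \<zeta> k * \<zeta> k)) / 2 +
      Re (a * u * (\<Sum>ks\<in>?W. \<Prod>k\<leftarrow>ks. cnj (\<zeta> k) * \<zeta> k)) / 2"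
  proof -
    have "(\<Prod>k\<leftarrow>ks. \<zeta> k * \<zeta> k) = prod_list (map \<zeta> ks) * prod_list (map \<zeta> ks)"
      "(\<Prod>k\<leftarrow>ks. cnj (\<zeta> k) * \<zeta> k) = cnj (prod_list (map \<zeta> ks)) * prod_list (map \<zeta> ks)" for ks
      by (induction ks) (simp_all add: mult_ac)
    then show ?thesis
      by (simp only: Re_mult sum.distrib sum_distrib_left Re_sum sum_divide_distrib)
  qed
  also have "\<dots> = Re (a * u * 2 ^ m) / 2"
    using assms(1) by (simp add: sum_words_prod sum_Basis_plane power_0_left)
  also have "\<dots> = 2 ^ (m - 1) * Re (a * u)"
  proof -
    have "Re (a * u * 2 ^ m) = 2 ^ m * Re (a * u)"
      using Re_of_real_mult[of "2 ^ m" "a * u"] by (simp only: of_real_power of_real_numeral mult.commute)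
    with assms(1) show ?thesis by (cases m) auto
  qed
  finally show ?thesis by (simp add: u_def mult_ac)
qed

text \<open>
  Both sides are symmetric, so it suffices to compare their polynomials. The two terms of the
  determinant combine by \<open>Im u * Re v - Re u * Im v = Im (u * cnj v)\<close>.
\<close>

lemma cross_harmonic_form:
  assumes "1 \<le> m" "1 \<le> n"
  shows "cross m n (harmonic_form m a) (harmonic_form n b) =
    mixed_form (m + n - 2) (m - 1) (a * cnj b / of_nat ((m + n - 2) choose (m - 1)))"
proof (rule sym_tensor_eqI)
  show "cross m n (harmonic_form m a) (harmonic_form n b) \<in> sym_tensors (m + n - 2)"
    using assms by (intro cross_sym_tensors sym_tensors_tensors harmonic_form_sym_tensors)
  fix x
  have pos: "((m + n - 2) choose (m - 1)) \<noteq> 0" using assms by auto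
  have "phi (m + n - 2) (cross m n (harmonic_form m a) (harmonic_form n b)) x =
      Re (cnj a * \<zeta> x ^ (m - 1) * \<i>) * Re (cnj b * \<zeta> x ^ (n - 1)) -
      Re (cnj a * \<zeta> x ^ (m - 1)) * Re (cnj b * \<zeta> x ^ (n - 1) * \<i>)"
    using assms by (simp add: phi_cross harmonic_form_def mult_ac)
  also have "\<dots> = Im (a * cnj b * cnj (\<zeta> x) ^ (m - 1) * \<zeta> x ^ (n - 1))"
  proof -
    have "Re (u * \<i>) * Re v - Re u * Re (v * \<i>) = Im (cnj u * v)" for u v
      by (simp add: algebra_simps)
    from this[of "cnj a * \<zeta> x ^ (m - 1)" "cnj b * \<zeta> x ^ (n - 1)"] show ?thesis
      by (simp add: mult_ac)
  qed
  also have "\<dots> = phi (m + n - 2)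
      (mixed_form (m + n - 2) (m - 1) (a * cnj b / of_nat ((m + n - 2) choose (m - 1)))) x"
  proof -
    have "m + n - 2 - (m - 1) = n - 1" using assms by simp
    moreover have "Im (w / of_nat k * y * v) = Im (w * y * v) / of_nat k" for w y v k
      by (metis Im_divide_of_nat times_divide_eq_left)
    ultimately show ?thesis using pos assms by (subst phi_mixed_form) auto
  qed
  finally show "phi (m + n - 2) (cross m n (harmonic_form m a) (harmonic_form n b)) x = \<dots>" .
qed (rule mixed_form_sym_tensors)

lemma phi_trace_cross_harmonic_form:
  assumes "1 \<le> m" "m \<le> n"
  shows "phi (n - m) ((tensor_trace ^^ (m - 1)) (cross m n (harmonic_form m a) (harmonic_form n b))) x =
    4 ^ (m - 1) * (fact (m - 1) * fact (n - 1) / fact (m + n - 2)) * Im (a * cnj b * \<zeta> x ^ (n - m))"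
proof -
  have order: "m + n - 2 = (n - m) + 2 * (m - 1)" using assms by simp
  have "phi (n - m) ((tensor_trace ^^ (m - 1)) (cross m n (harmonic_form m a) (harmonic_form n b))) x =
      Im (4 ^ (m - 1) * (a * cnj b / of_nat ((m + n - 2) choose (m - 1))) * \<zeta> x ^ (n - m))"
    using assms unfolding cross_harmonic_form[OF assms(1) order_trans[OF assms]] order
      tensor_trace_power_mixed_form by (simp only: phi_mixed_form le0) simp
  also have "\<dots> = 4 ^ (m - 1) * Im (a * cnj b * \<zeta> x ^ (n - m)) / of_nat ((m + n - 2) choose (m - 1))"
  proof -
    have "Im (4 ^ k * (w / of_nat l) * y) = 4 ^ k * Im (w * y) / of_nat l" for k l w y
    proof -
      have "4 ^ k * (w / of_nat l) * y = of_real (4 ^ k / of_nat l) * (w * y)" by simp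
      then show ?thesis by (simp only: Im_of_real_mult) simp
    qed
    then show ?thesis .
  qed
  also have "real ((m + n - 2) choose (m - 1)) = fact (m + n - 2) / (fact (m - 1) * fact (n - 1))"
    using assms by (subst binomial_fact) auto
  finally show ?thesis by (simp add: mult_ac)
qed

text \<open>
  Summing \<open>det (x, b) \<zeta> b\<close> over the basis vectors \<open>b\<close> gives \<open>\<i> \<zeta> x\<close>, so the cross product with the
  identity turns one argument by a right angle.
\<close>

lemma phi_id_cross_harmonic_form:
  assumes "1 \<le> n"
  shows "phi n (cross 2 n id_tensor (harmonic_form n a)) x = Re (cnj (\<i> * a) * \<zeta> x ^ n)"
proof -
  have "phi (2 + n - 2) (cross 2 n id_tensor (harmonic_form n a)) x =
      x $ 2 * Re (cnj a * \<zeta> x ^ (n - 1)) - x $ 1 * Re (cnj a * \<zeta> x ^ (n - 1) * \<i>)"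
    using assms by (subst phi_cross) (auto simp: id_tensor_def harmonic_form_def inner_axis mult_ac)
  also have "\<dots> = Re (cnj (\<i> * a) * (\<zeta> x ^ (n - 1) * \<zeta> x))"
    by (simp add: plane_to_complex_def algebra_simps)
  also have "\<zeta> x ^ (n - 1) * \<zeta> x = \<zeta> x ^ n"
    using assms by (cases n) (auto simp: mult_ac)
  finally show ?thesis by simp
qed

section \<open>The leading harmonic part of a product\<close>

lemma real_polynomial_function_\<zeta>_power:
  "real_polynomial_function (\<lambda>x. Re (\<zeta> x ^ n)) \<and> real_polynomial_function (\<lambda>x. Im (\<zeta> x ^ n))"
proof (induction n)
  case 0
  show ?case by (simp add: real_polynomial_function.intros(2))
next
  case (Suc n)
  have "real_polynomial_function (\<lambda>x. x $ 1 * Re (\<zeta> x ^ n) - x $ 2 * Im (\<zeta> x ^ n))"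
    "real_polynomial_function (\<lambda>x. x $ 1 * Im (\<zeta> x ^ n) + x $ 2 * Re (\<zeta> x ^ n))"
    using Suc.IH
    by (intro real_polynomial_function_diff real_polynomial_function.intros(3,4)
        real_polynomial_function_nth; simp)+
  then show ?case by (simp add: plane_to_complex_def)
qed

lemma has_derivative_Re_power_on_line:
  "((\<lambda>t. Re (c * (w + of_real t * u) ^ n)) has_real_derivative
     Re (of_nat n * u * c * (w + of_real t * u) ^ (n - 1))) (at t)"
proof -
  have "((\<lambda>s. c * (w + s * u) ^ n) has_field_derivative
      of_nat n * u * c * (w + of_real t * u) ^ (n - 1)) (at (of_real t))"
    by (auto intro!: derivative_eq_intros)
  from has_vector_derivative_real_field[OF this]
  have "((\<lambda>t. c * (w + of_real t * u) ^ n) has_vector_derivative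
      of_nat n * u * c * (w + of_real t * u) ^ (n - 1)) (at t)"
    by (simp add: o_def)
  then show ?thesis
    by (rule has_field_derivative_Re)
qed

lemma homogeneous_harmonic_Re_power: "homogeneous_harmonic n (\<lambda>x. Re (cnj a * \<zeta> x ^ n))"
proof -
  have "laplacian (\<lambda>x. Re (cnj a * \<zeta> x ^ n)) x = 0" for x
  proof -
    have deriv: "deriv (\<lambda>t. Re (c * (w + of_real t * u) ^ k)) =
        (\<lambda>t. Re (of_nat k * u * c * (w + of_real t * u) ^ (k - 1)))" for c w u k
      by (rule ext, rule DERIV_imp_deriv, rule has_derivative_Re_power_on_line)
    have "(deriv ^^ 2) (\<lambda>t. Re (cnj a * \<zeta> (x + t *\<^sub>R b) ^ n)) 0 =
        Re (\<zeta> b * \<zeta> b * (of_nat (n - 1) * of_nat n * cnj a * \<zeta> x ^ (n - 1 - 1)))" for b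
      unfolding numeral_2_eq_2 funpow.simps o_def id_def \<zeta>_add \<zeta>_scale
      by (simp only: deriv) (simp add: mult_ac del: times_complex.simps)
    then show ?thesis
      by (simp add: laplacian_def sum_Basis_plane)
  qed
  moreover have "real_polynomial_function (\<lambda>x. Re (cnj a * \<zeta> x ^ n))"
  proof -
    have "real_polynomial_function (\<lambda>x. Re a * Re (\<zeta> x ^ n) + Im a * Im (\<zeta> x ^ n))"
      using real_polynomial_function_\<zeta>_power[of n]
      by (intro real_polynomial_function.intros(2-4)) auto
    then show ?thesis by simp
  qed
  moreover have "Re (cnj a * \<zeta> (c *\<^sub>R x) ^ n) = c ^ n * Re (cnj a * \<zeta> x ^ n)" for c x
  proof -
    have "cnj a * \<zeta> (c *\<^sub>R x) ^ n = of_real (c ^ n) * (cnj a * \<zeta> x ^ n)"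
      by (simp add: power_mult_distrib)
    then show ?thesis by (simp only: Re_of_real_mult)
  qed
  ultimately show ?thesis by (simp add: homogeneous_harmonic_def)
qed

text \<open>
  Harmonic decompositions in complex notation. Only the leading coefficient \<open>c\<close> is kept track of.
\<close>

definition expands :: "nat \<Rightarrow> complex \<Rightarrow> (real^2 \<Rightarrow> real) \<Rightarrow> bool" where
  "expands N c f \<longleftrightarrow> (\<exists>a. a 0 = c \<and>
     (\<forall>x. f x = (\<Sum>k\<le>N div 2. ((x $ 1)\<^sup>2 + (x $ 2)\<^sup>2) ^ k * Re (cnj (a k) * \<zeta> x ^ (N - 2 * k)))))"

lemma expands_single:
  assumes "m \<le> N div 2"
  shows "expands N (if m = 0 then c else 0)
    (\<lambda>x. ((x $ 1)\<^sup>2 + (x $ 2)\<^sup>2) ^ m * Re (cnj c * \<zeta> x ^ (N - 2 * m)))"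
  unfolding expands_def
proof (intro exI[of _ "\<lambda>k. if k = m then c else 0"] conjI allI)
  fix x :: "real^2"
  have "(\<Sum>k\<le>N div 2. ((x $ 1)\<^sup>2 + (x $ 2)\<^sup>2) ^ k * Re (cnj (if k = m then c else 0) * \<zeta> x ^ (N - 2 * k))) =
      (\<Sum>k\<le>N div 2. if k = m then ((x $ 1)\<^sup>2 + (x $ 2)\<^sup>2) ^ k * Re (cnj c * \<zeta> x ^ (N - 2 * k)) else 0)"
    by (rule sum.cong) auto
  then show "((x $ 1)\<^sup>2 + (x $ 2)\<^sup>2) ^ m * Re (cnj c * \<zeta> x ^ (N - 2 * m)) = 
      (\<Sum>k\<le>N div 2. ((x $ 1)\<^sup>2 + (x $ 2)\<^sup>2) ^ k * Re (cnj (if k = m then c else 0) * \<zeta> x ^ (N - 2 * k)))"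
    using assms by (simp add: sum.delta)
qed auto

lemma expands_add:
  assumes "expands N c f" "expands N d g"
  shows "expands N (c + d) (\<lambda>x. f x + g x)"
proof -
  obtain a b where "a 0 = c" "b 0 = d"
    "\<And>x. f x = (\<Sum>k\<le>N div 2. ((x $ 1)\<^sup>2 + (x $ 2)\<^sup>2) ^ k * Re (cnj (a k) * \<zeta> x ^ (N - 2 * k)))"
    "\<And>x. g x = (\<Sum>k\<le>N div 2. ((x $ 1)\<^sup>2 + (x $ 2)\<^sup>2) ^ k * Re (cnj (b k) * \<zeta> x ^ (N - 2 * k)))"
    using assms unfolding expands_def by blast
  then show ?thesis
    unfolding expands_def
    by (intro exI[of _ "\<lambda>k. a k + b k"]) (simp add: sum.distrib[symmetric] algebra_simps)
qed

lemma expands_sum: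
  assumes "finite K" "\<And>k. k \<in> K \<Longrightarrow> expands N (c k) (f k)"
  shows "expands N (\<Sum>k\<in>K. c k) (\<lambda>x. \<Sum>k\<in>K. f k x)"
  using assms
proof (induction K rule: finite_induct)
  case empty
  show ?case using expands_single[of 0 N 0] by simp
next
  case (insert k K)
  then show ?case by (simp add: expands_add)
qed

text \<open>
  The product of two powers is half the sum of \<open>Re (cnj (a b) \<zeta>\<^sup>m\<^sup>+\<^sup>n)\<close> and of
  \<open>Re (a cnj b cnj \<zeta>\<^sup>m \<zeta>\<^sup>n)\<close>, and the second of these is divisible by \<open>\<zeta> cnj \<zeta>\<close>, to the power \<open>min m n\<close>.
\<close>

lemma Re_power_mult_Re_power:
  "\<exists>d. \<forall>x. Re (cnj a * \<zeta> x ^ m) * Re (cnj b * \<zeta> x ^ n) =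
     Re (cnj (a * b / 2) * \<zeta> x ^ (m + n)) +
     ((x $ 1)\<^sup>2 + (x $ 2)\<^sup>2) ^ min m n * Re (cnj d * \<zeta> x ^ (m + n - 2 * min m n))"
proof -
  have split: "Re u * Re v = Re (u * v / 2) + Re (cnj u * v / 2)" for u v
    by (simp add: field_simps)
  have q: "cnj (\<zeta> x) ^ k * \<zeta> x ^ k = of_real (((x $ 1)\<^sup>2 + (x $ 2)\<^sup>2) ^ k)" for x k
    by (simp only: power_mult_distrib[symmetric] mult.commute[of "cnj _"] \<zeta>_cnj of_real_power)
  have first: "cnj a * \<zeta> x ^ m * (cnj b * \<zeta> x ^ n) / 2 = cnj (a * b / 2) * \<zeta> x ^ (m + n)" for x
    by (simp add: power_add mult_ac)
  show ?thesis
  proof (cases "m \<le> n")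
    case True
    have "Re (cnj (cnj a * \<zeta> x ^ m) * (cnj b * \<zeta> x ^ n) / 2) =
        ((x $ 1)\<^sup>2 + (x $ 2)\<^sup>2) ^ m * Re (cnj (cnj a * b / 2) * \<zeta> x ^ (n - m))" for x
    proof -
      have "\<zeta> x ^ n = \<zeta> x ^ m * \<zeta> x ^ (n - m)" using True by (simp flip: power_add)
      then have "cnj (cnj a * \<zeta> x ^ m) * (cnj b * \<zeta> x ^ n) / 2 =
          (cnj (\<zeta> x) ^ m * \<zeta> x ^ m) * (cnj (cnj a * b / 2) * \<zeta> x ^ (n - m))"
        by (simp add: mult_ac)
      then show ?thesis unfolding q by (simp only: Re_of_real_mult)
    qed
    moreover have "m + n - 2 * min m n = n - m" "min m n = m" using True by auto
    ultimately show ?thesis by (intro exI[of _ "cnj a * b / 2"] allI) (simp only: split first)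
  next
    case False
    have "Re (cnj (cnj a * \<zeta> x ^ m) * (cnj b * \<zeta> x ^ n) / 2) =
        ((x $ 1)\<^sup>2 + (x $ 2)\<^sup>2) ^ n * Re (cnj (a * cnj b / 2) * \<zeta> x ^ (m - n))" for x
    proof -
      have "\<zeta> x ^ m = \<zeta> x ^ n * \<zeta> x ^ (m - n)" using False by (simp flip: power_add)
      then have "cnj (cnj a * \<zeta> x ^ m) * (cnj b * \<zeta> x ^ n) / 2 =
          (cnj (\<zeta> x) ^ n * \<zeta> x ^ n) * cnj (cnj (a * cnj b / 2) * \<zeta> x ^ (m - n))"
        by (simp add: mult_ac)
      then show ?thesis unfolding q by (simp only: Re_of_real_mult cnj.simps)
    qed
    moreover have "m + n - 2 * min m n = m - n" "min m n = n" using False by auto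
    ultimately show ?thesis by (intro exI[of _ "a * cnj b / 2"] allI) (simp only: split first)
  qed
qed

lemma expands_mult:
  assumes f: "expands N c f" and "1 \<le> N" "1 \<le> n"
  shows "expands (n + N) (b * c / 2) (\<lambda>x. Re (cnj b * \<zeta> x ^ n) * f x)"
proof -
  define q :: "real^2 \<Rightarrow> real" where "q x = (x $ 1)\<^sup>2 + (x $ 2)\<^sup>2" for x
  obtain a where a: "a 0 = c"
    "\<And>x. f x = (\<Sum>k\<le>N div 2. q x ^ k * Re (cnj (a k) * \<zeta> x ^ (N - 2 * k)))"
    using f unfolding expands_def q_def by blast
  have "expands (n + N) (if k = 0 then b * a k / 2 else 0)
      (\<lambda>x. q x ^ k * (Re (cnj b * \<zeta> x ^ n) * Re (cnj (a k) * \<zeta> x ^ (N - 2 * k))))"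
    if k: "k \<le> N div 2" for k
  proof -
    define l where "l = min n (N - 2 * k)"
    obtain d where d: "\<And>x. Re (cnj b * \<zeta> x ^ n) * Re (cnj (a k) * \<zeta> x ^ (N - 2 * k)) =
        Re (cnj (b * a k / 2) * \<zeta> x ^ (n + (N - 2 * k))) +
        q x ^ l * Re (cnj d * \<zeta> x ^ (n + (N - 2 * k) - 2 * l))"
      using Re_power_mult_Re_power[of b n "a k" "N - 2 * k"] unfolding q_def l_def by blast
    have exps: "n + (N - 2 * k) = n + N - 2 * k" using k by auto
    have "l > 0 \<or> k > 0" using assms by (auto simp: l_def)
    moreover have "k \<le> (n + N) div 2" "k + l \<le> (n + N) div 2" using k by (auto simp: l_def)
    ultimately have "expands (n + N) ((if k = 0 then b * a k / 2 else 0) + 0)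
        (\<lambda>x. q x ^ k * Re (cnj (b * a k / 2) * \<zeta> x ^ (n + N - 2 * k)) +
          q x ^ (k + l) * Re (cnj d * \<zeta> x ^ (n + N - 2 * (k + l))))"
      using expands_single[of k "n + N" "b * a k / 2"] expands_single[of "k + l" "n + N" d]
      unfolding q_def by (intro expands_add) auto
    then show ?thesis unfolding d exps by (simp only: add_0_right distrib_left power_add mult.assoc diff_diff_left)
  qed
  then have "expands (n + N) (\<Sum>k\<le>N div 2. if k = 0 then b * a k / 2 else 0)
      (\<lambda>x. \<Sum>k\<le>N div 2. q x ^ k * (Re (cnj b * \<zeta> x ^ n) * Re (cnj (a k) * \<zeta> x ^ (N - 2 * k))))"
    by (intro expands_sum) auto
  also have "(\<Sum>k\<le>N div 2. if k = 0 then b * a k / 2 else 0) = b * c / 2"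
    using a(1) by (simp add: sum.delta)
  finally show ?thesis
    unfolding a(2) sum_distrib_left by (simp only: mult.left_commute)
qed

lemma phi_sym_prod: "phi (m + n) (sym_prod m n S T) x = phi m S x * phi n T x"
  unfolding sym_prod_def phi_symmetrize by (simp add: phi_def tensor_prod_def min_def)

lemma phi_sym_prods: "phi (\<Sum>j\<leftarrow>js. n j) (sym_prods n H js) x = (\<Prod>j\<leftarrow>js. phi (n j) (H j) x)"
proof (induction n H js rule: sym_prods.induct)
  case (3 n H j k js)
  then show ?case using phi_sym_prod[of "n j"] by simp
qed (simp_all add: phi_def)

text \<open>
  Each of the \<open>k\<close> factors contributes its coefficient, and each of the \<open>k - 1\<close> multiplications a factor
  \<open>1/2\<close>; the constant \<open>2\<^sup>1\<^sup>-\<^sup>k\<close> is distributed over the product in the form \<open>2 \<Prod> (z\<^sub>j / 2)\<close>.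
\<close>

lemma expands_prod_list:
  fixes n :: "nat \<Rightarrow> nat" and z :: "nat \<Rightarrow> complex"
  assumes "js \<noteq> []" "\<And>j. j \<in> set js \<Longrightarrow> 1 \<le> n j"
  shows "expands (\<Sum>j\<leftarrow>js. n j) (2 * (\<Prod>j\<leftarrow>js. z j / 2)) (\<lambda>x. \<Prod>j\<leftarrow>js. Re (cnj (z j) * \<zeta> x ^ n j))"
  using assms
proof (induction js rule: list_nonempty_induct)
  case (single j)
  show ?case using expands_single[of 0 "n j" "z j"] by (simp del: times_complex.simps)
next
  case (cons j js)
  have "1 \<le> (\<Sum>j\<leftarrow>js. n j)"
    using cons.hyps cons.prems[of "hd js"] by (cases js) auto
  moreover have "expands (\<Sum>j\<leftarrow>js. n j) (2 * (\<Prod>j\<leftarrow>js. z j / 2))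
      (\<lambda>x. \<Prod>j\<leftarrow>js. Re (cnj (z j) * \<zeta> x ^ n j))"
    by (rule cons.IH) (use cons.prems in auto)
  moreover have "1 \<le> n j" using cons.prems by simp
  ultimately have "expands (n j + (\<Sum>j\<leftarrow>js. n j)) (z j * (2 * (\<Prod>j\<leftarrow>js. z j / 2)) / 2)
      (\<lambda>x. Re (cnj (z j) * \<zeta> x ^ n j) * (\<Prod>j\<leftarrow>js. Re (cnj (z j) * \<zeta> x ^ n j)))"
    by (intro expands_mult)
  then show ?case by (simp del: times_complex.simps)
qed

lemma leading_harmonic_sym_prods:
  assumes "js \<noteq> []" "\<And>j. j \<in> set js \<Longrightarrow> 1 \<le> n j"
    and "\<And>j x. j \<in> set js \<Longrightarrow> phi (n j) (H j) x = Re (cnj (z j) * \<zeta> x ^ n j)"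
  shows "leading_harmonic (\<Sum>j\<leftarrow>js. n j) (sym_prods n H js) =
    harmonic_form (\<Sum>j\<leftarrow>js. n j) (2 * (\<Prod>j\<leftarrow>js. z j / 2))"
proof -
  let ?N = "\<Sum>j\<leftarrow>js. n j"
  have "phi ?N (sym_prods n H js) = (\<lambda>x. \<Prod>j\<leftarrow>js. Re (cnj (z j) * \<zeta> x ^ n j))"
    unfolding phi_sym_prods[abs_def] fun_eq_iff
    using assms(3) by (intro allI arg_cong[of _ _ prod_list] map_cong) auto
  then have "expands ?N (2 * (\<Prod>j\<leftarrow>js. z j / 2)) (phi ?N (sym_prods n H js))"
    using expands_prod_list[where js = js and n = n and z = z, OF assms(1,2)] by simp
  then obtain a where a: "a 0 = 2 * (\<Prod>j\<leftarrow>js. z j / 2)"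
    "\<And>x. phi ?N (sym_prods n H js) x =
      (\<Sum>k\<le>?N div 2. ((x $ 1)\<^sup>2 + (x $ 2)\<^sup>2) ^ k * Re (cnj (a k) * \<zeta> x ^ (?N - 2 * k)))"
    unfolding expands_def by blast
  show ?thesis
  proof (rule leading_harmonic_eqI[OF harmonic_form_sym_tensors])
    show "harmonic_decomposition ?N (phi ?N (sym_prods n H js))
        (\<lambda>k x. Re (cnj (a k) * \<zeta> x ^ (?N - 2 * k)))"
      using a(2) homogeneous_harmonic_Re_power by (simp add: harmonic_decomposition_def)
    show "phi ?N (harmonic_form ?N (2 * (\<Prod>j\<leftarrow>js. z j / 2))) = (\<lambda>x. Re (cnj (a 0) * \<zeta> x ^ (?N - 2 * 0)))"
      using a(1) by (simp add: phi_harmonic_form fun_eq_iff)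
  qed
qed

lemma harmonic_tensor_eq_harmonic_form:
  assumes "H \<in> harmonic_tensors n" "\<And>x. phi n H x = Re (cnj z * \<zeta> x ^ n)"
  shows "H = harmonic_form n z"
  by (rule sym_tensor_eqI[OF _ harmonic_form_sym_tensors])
    (use assms in \<open>auto simp: harmonic_tensors_def phi_harmonic_form\<close>)

section \<open>The formulas for the real and imaginary parts\<close>

theorem theorem7p4:
  fixes p s N1 N2 :: nat
    and n :: "nat \<Rightarrow> nat"
    and H :: "nat \<Rightarrow> tensor"
    and z :: "nat \<Rightarrow> complex"
    and x :: "real^2"
  assumes "p \<ge> 1" and "s \<ge> 1"
    and "\<And>j. j \<in> {1..p+s} \<Longrightarrow> n j \<ge> 1"
    and "\<And>j. j \<in> {1..p+s} \<Longrightarrow> H j \<in> harmonic_tensors (n j)"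
    and "\<And>j y. j \<in> {1..p+s} \<Longrightarrow> phi (n j) (H j) y = Re (cnj (z j) * plane_to_complex y ^ n j)"
    and "N1 = (\<Sum>j=1..p. n j)"
    and "N2 = (\<Sum>j=p+1..p+s. n j)"
    and "N1 \<le> N2"
  shows "let
      w = (\<Prod>j=1..p. z j) * (\<Prod>j=p+1..p+s. cnj (z j)) * plane_to_complex x ^ (N2 - N1);
      A = leading_harmonic N1 (sym_prods n H [1..<p+1]);
      B = leading_harmonic N2 (sym_prods n H [p+1..<p+s+1]);
      A' = leading_harmonic N1
             (sym_prods n (H(1 := cross 2 (n 1) id_tensor (H 1))) [1..<p+1]);
      B' = leading_harmonic N2
             (sym_prods n (H(p+1 := cross 2 (n (p+1)) id_tensor (H (p+1)))) [p+1..<p+s+1])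
    in
      Re w = 2 powi (int p + int s - 1 - int N1) * phi (N2 - N1) (contract N1 N1 N2 A B) x
    \<and> Im w = 2 powi (int p + int s - 2 * int N1) * fact (N1 + N2 - 2)
               / (fact (N1 - 1) * fact (N2 - 1))
               * phi (N2 - N1) ((tensor_trace ^^ (N1 - 1)) (cross N1 N2 A B)) x
    \<and> Im w = 2 powi (int p + int s - 1 - int N1) * phi (N2 - N1) (contract N1 N1 N2 A B') x
    \<and> Im w = - (2 powi (int p + int s - 1 - int N1)) * phi (N2 - N1) (contract N1 N1 N2 A' B) x"
proof -
  let ?J = "[1..<p+1]" and ?K = "[p+1..<p+s+1]"
  have set_J: "set ?J = {1..p}" and set_K: "set ?K = {p+1..p+s}" by auto
  have lists: "?J \<noteq> []" "?K \<noteq> []" using assms(1,2) by auto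
  have N1: "(\<Sum>j\<leftarrow>?J. n j) = N1" and N2: "(\<Sum>j\<leftarrow>?K. n j) = N2"
    unfolding sum_list_distinct_conv_sum_set[OF distinct_upt] set_J set_K assms(6,7) by auto
  have "n 1 \<le> N1"
    unfolding assms(6) using assms(1) by (intro member_le_sum) auto
  then have "1 \<le> N1" using assms(1) assms(3)[of 1] by simp
  have H: "H j = harmonic_form (n j) (z j)" if "j \<in> {1..p+s}" for j
    using assms(4,5) that by (intro harmonic_tensor_eq_harmonic_form)

  define P where "P = (\<Prod>j=1..p. z j)"
  define Q where "Q = (\<Prod>j=p+1..p+s. z j)"
  have prod_J: "2 * (\<Prod>j\<leftarrow>?J. y j / 2) = of_real (2 / 2 ^ p) * (\<Prod>j=1..p. y j)" for y :: "nat \<Rightarrow> complex"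
    unfolding prod.distinct_set_conv_list[OF distinct_upt, symmetric] set_J by (simp add: prod_dividef)
  have prod_K: "2 * (\<Prod>j\<leftarrow>?K. y j / 2) = of_real (2 / 2 ^ s) * (\<Prod>j=p+1..p+s. y j)" for y :: "nat \<Rightarrow> complex"
    unfolding prod.distinct_set_conv_list[OF distinct_upt, symmetric] set_K by (simp add: prod_dividef)

  have A: "leading_harmonic N1 (sym_prods n H ?J) = harmonic_form N1 (of_real (2 / 2 ^ p) * P)"
    using leading_harmonic_sym_prods[OF lists(1), of n H z] assms(3,5)
    unfolding N1 prod_J P_def set_J by auto
  have B: "leading_harmonic N2 (sym_prods n H ?K) = harmonic_form N2 (of_real (2 / 2 ^ s) * Q)"
    using leading_harmonic_sym_prods[OF lists(2), of n H z] assms(3,5)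
    unfolding N2 prod_K Q_def set_K by auto

  \<comment> \<open>Replacing one factor by its cross product with the identity multiplies its coefficient by \<open>\<i>\<close>.\<close>
  have rotated: "phi (n j) ((H(k := cross 2 (n k) id_tensor (H k))) j) y =
      Re (cnj ((z(k := \<i> * z k)) j) * \<zeta> y ^ n j)"
    if "j \<in> {1..p+s}" for j k y
    using that assms(3,5) by (auto simp: phi_id_cross_harmonic_form H simp del: times_complex.simps)
  have rotated_P: "(\<Prod>j=1..p. (z(1 := \<i> * z 1)) j) = \<i> * P"
    unfolding P_def using assms(1) by (subst (1 2) prod.remove[of _ 1]) auto
  have rotated_Q: "(\<Prod>j=p+1..p+s. (z(p+1 := \<i> * z (p+1))) j) = \<i> * Q"
    unfolding Q_def using assms(2) by (subst (1 2) prod.remove[of _ "p+1"]) auto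
  have A': "leading_harmonic N1 (sym_prods n (H(1 := cross 2 (n 1) id_tensor (H 1))) ?J) =
      harmonic_form N1 (of_real (2 / 2 ^ p) * (\<i> * P))"
    using leading_harmonic_sym_prods[OF lists(1), of n "H(1 := cross 2 (n 1) id_tensor (H 1))" "z(1 := \<i> * z 1)"]
      assms(3) rotated
    unfolding N1 prod_J rotated_P set_J by auto
  have B': "leading_harmonic N2 (sym_prods n (H(p+1 := cross 2 (n (p+1)) id_tensor (H (p+1)))) ?K) =
      harmonic_form N2 (of_real (2 / 2 ^ s) * (\<i> * Q))"
    using leading_harmonic_sym_prods[OF lists(2), of n "H(p+1 := cross 2 (n (p+1)) id_tensor (H (p+1)))"
        "z(p+1 := \<i> * z (p+1))"] assms(3) rotated
    unfolding N2 prod_K rotated_Q set_K by auto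

  define w where "w = P * cnj Q * \<zeta> x ^ (N2 - N1)"
  have w: "(\<Prod>j=1..p. z j) * (\<Prod>j=p+1..p+s. cnj (z j)) * \<zeta> x ^ (N2 - N1) = w"
    by (simp add: w_def P_def Q_def)
  have coeff: "of_real c * a * cnj (of_real d * b) * y = of_real (c * d) * (a * cnj b * y)"
    for c d and a b y :: complex
    by simp
  have contr: "phi (N2 - N1) (contract N1 N1 N2 (harmonic_form N1 (of_real (2 / 2 ^ p) * a))
      (harmonic_form N2 (of_real (2 / 2 ^ s) * b))) x =
      2 ^ (N1 - 1) * (2 / 2 ^ p * (2 / 2 ^ s)) * Re (a * cnj b * \<zeta> x ^ (N2 - N1))" for a b
    unfolding phi_contract_harmonic_form[OF \<open>1 \<le> N1\<close> \<open>N1 \<le> N2\<close>] coeff Re_of_real_mult by simp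
  \<comment> \<open>The prefactors compensate the powers of two left by the products, contractions and traces.\<close>
  have const: "(2 :: real) powi (int p + int s - 1 - int N1) * (2 ^ (N1 - 1) * (2 / 2 ^ p * (2 / 2 ^ s))) = 1"
    using \<open>1 \<le> N1\<close>
    by (cases N1) (auto simp: power_int_diff power_int_add field_simps)
  have const': "(2 :: real) powi (int p + int s - 2 * int N1) * (4 ^ (N1 - 1) * (2 / 2 ^ p * (2 / 2 ^ s))) = 1"
    using \<open>1 \<le> N1\<close>
    by (cases N1) (auto simp: power_int_diff power_int_add power_int_mult field_simps power2_eq_square
        simp flip: power_mult_distrib)

  have "Re w = 2 powi (int p + int s - 1 - int N1) *
      (2 ^ (N1 - 1) * (2 / 2 ^ p * (2 / 2 ^ s)) * Re (P * cnj Q * \<zeta> x ^ (N2 - N1)))"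
    using const by (simp only: mult.assoc[symmetric] w_def mult_1_left)
  moreover have "Im w = 2 powi (int p + int s - 1 - int N1) *
      (2 ^ (N1 - 1) * (2 / 2 ^ p * (2 / 2 ^ s)) * Re (P * cnj (\<i> * Q) * \<zeta> x ^ (N2 - N1)))"
  proof -
    have "P * cnj (\<i> * Q) * \<zeta> x ^ (N2 - N1) = - \<i> * w" by (simp add: w_def mult_ac)
    then have "Re (P * cnj (\<i> * Q) * \<zeta> x ^ (N2 - N1)) = Im w" by (simp only:) simp
    then show ?thesis using const by (simp only: mult.assoc[symmetric] mult_1_left)
  qed
  moreover have "Im w = - (2 powi (int p + int s - 1 - int N1)) *
      (2 ^ (N1 - 1) * (2 / 2 ^ p * (2 / 2 ^ s)) * Re (\<i> * P * cnj Q * \<zeta> x ^ (N2 - N1)))"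
  proof -
    have "\<i> * P * cnj Q * \<zeta> x ^ (N2 - N1) = \<i> * w" by (simp add: w_def mult_ac)
    then have "Re (\<i> * P * cnj Q * \<zeta> x ^ (N2 - N1)) = - Im w" by (simp only:) simp
    then show ?thesis using const by (simp only: mult.assoc[symmetric] mult_minus_left mult_minus_right mult_1_left minus_minus)
  qed
  moreover have "Im w = 2 powi (int p + int s - 2 * int N1) * fact (N1 + N2 - 2) / (fact (N1 - 1) * fact (N2 - 1)) *
      phi (N2 - N1) ((tensor_trace ^^ (N1 - 1)) (cross N1 N2
        (harmonic_form N1 (of_real (2 / 2 ^ p) * P)) (harmonic_form N2 (of_real (2 / 2 ^ s) * Q)))) x"
  proof -
    have cancel: "c * f / (g * h) * (d * (g * h / f) * (e * v)) = v"
      if "c * (d * e) = 1" "f \<noteq> 0" "g \<noteq> 0" "h \<noteq> 0" for c d e f g h v :: real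
    proof -
      have "c * f / (g * h) * (d * (g * h / f) * (e * v)) = c * (d * e) * v"
        using that(2-4) by (simp add: field_simps)
      then show ?thesis using that(1) by simp
    qed
    show ?thesis
      unfolding phi_trace_cross_harmonic_form[OF \<open>1 \<le> N1\<close> \<open>N1 \<le> N2\<close>] coeff Im_of_real_mult w_def[symmetric]
      by (rule cancel[symmetric, OF const']) auto
  qed
  ultimately show ?thesis
    unfolding Let_def A B A' B' contr w by blast
qed

end
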